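(* Let $r(x)=\sum_{n\ge 0}x^{2^n-1}$ and $B(x)=1-xr(x)=1-\sum_{k\ge 0}x^{2^k}$. Let $(j_n)_{n\ge 0}$ be defined by $j_0=0$, $j_{2k}=j_k$, $j_{2k+1}=(-1)^k$, and $s_n=1+\sum_{0\le k\le n}j_k$. Then for every $n\ge 0$, $|H_{n+1}(B(x))|=s_n$.
   Context: For a power series $f(x)=\sum_{i\ge 0}a_ix^i$ and $n\ge 1$, the Hankel determinant $H_n(f)$ is the determinant of the $n\times n$ matrix $(a_{i+j})_{0\le i,j\le n-1}$; $H_0(f)=1$. *)

theory Defs
  imports
    "HOL-Computational_Algebra.Formal_Power_Series"
    "Jordan_Normal_Form.Determinant"
begin

definition hankel_det :: "'a::comm_ring_1 fps \<Rightarrow> nat \<Rightarrow> 'a" where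
  "hankel_det f n = det (mat n n (\<lambda>(i, j). fps_nth f (i + j)))"

lemma hankel_det_0 [simp]: "hankel_det f 0 = 1"
  by (simp add: hankel_det_def)

text \<open>
  Infinite sums of power series are taken in the X-adic metric topology on
  \<^typ>\<open>int fps\<close>.  Since \<^const>\<open>suminf\<close> is unspecified on divergent series, convergence
  is proved below.
\<close>

definition r_fps :: "int fps" where
  "r_fps = (\<Sum>n. fps_X ^ (2 ^ n - 1))"

definition B_fps :: "int fps" where
  "B_fps = 1 - fps_X * r_fps"

lemma fps_sums_monomials:
  fixes e :: "nat \<Rightarrow> nat"
  assumes "strict_mono e"
  shows "(\<lambda>n. fps_X ^ e n) sums Abs_fps (\<lambda>m. if m \<in> range e then 1 else (0 :: int))"
  unfolding sums_def
proof (rule tendsto_fpsI)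
  fix m
  have *: "fps_nth (\<Sum>n<N. fps_X ^ e n :: int fps) m =
           fps_nth (Abs_fps (\<lambda>m. if m \<in> range e then 1 else 0)) m"
    if "N > m" for N
  proof (cases "m \<in> range e")
    case True
    then obtain k where k: "m = e k" by auto
    have "k \<le> e k"
      using assms by (rule strict_mono_imp_increasing)
    then have "k < N" using k that by simp
    have "fps_nth (\<Sum>n<N. fps_X ^ e n :: int fps) m = (\<Sum>n<N. if n = k then 1 else 0)"
      using strict_mono_eq[OF assms] k by (auto simp: fps_sum_nth fps_X_power_nth intro!: sum.cong)
    also have "\<dots> = 1" using \<open>k < N\<close> by simp
    finally show ?thesis using True by simp
  next
    case False
    then show ?thesis by (auto simp: fps_sum_nth fps_X_power_nth intro!: sum.neutral)
  qed
  show "\<forall>\<^sub>F N in sequentially. fps_nth (\<Sum>n<N. fps_X ^ e n :: int fps) m =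
          fps_nth (Abs_fps (\<lambda>m. if m \<in> range e then 1 else 0)) m"
    using eventually_gt_at_top[of m] by eventually_elim (rule *)
qed

lemma r_fps_sums: "(\<lambda>n. fps_X ^ (2 ^ n - 1)) sums r_fps"
proof -
  have "strict_mono (\<lambda>n. 2 ^ n - 1 :: nat)"
    by (auto simp: strict_mono_def intro!: diff_less_mono)
  from fps_sums_monomials[OF this] show ?thesis
    unfolding r_fps_def by (simp add: sums_iff)
qed

lemma r_fps_nth: "fps_nth r_fps m = (if \<exists>n. m = 2 ^ n - 1 then 1 else 0)"
proof -
  have "strict_mono (\<lambda>n. 2 ^ n - 1 :: nat)"
    by (auto simp: strict_mono_def intro!: diff_less_mono)
  from fps_sums_monomials[OF this]
  have "r_fps = Abs_fps (\<lambda>m. if m \<in> range (\<lambda>n. 2 ^ n - 1) then 1 else 0)"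
    using r_fps_sums sums_unique2 by blast
  from arg_cong[OF this, of "\<lambda>f. fps_nth f m"] show ?thesis
    by (simp add: image_iff)
qed

lemma B_fps_eq: "B_fps = 1 - (\<Sum>k. fps_X ^ (2 ^ k))"
proof -
  have "strict_mono (\<lambda>n. 2 ^ n :: nat)"
    by (auto simp: strict_mono_def)
  from fps_sums_monomials[OF this]
  have "(\<Sum>k. fps_X ^ (2 ^ k)) = Abs_fps (\<lambda>m. if m \<in> range (\<lambda>k. 2 ^ k) then 1 else (0 :: int))"
    by (simp add: sums_iff)
  also have "\<dots> = fps_X * r_fps"
  proof (rule fps_ext)
    fix m :: nat
    have "(\<exists>n. m = 2 ^ n) \<longleftrightarrow> m \<noteq> 0 \<and> (\<exists>n. m - 1 = 2 ^ n - 1)"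
      by (metis Suc_diff_1 neq0_conv power_not_zero zero_neq_numeral)
    then show "fps_nth (Abs_fps (\<lambda>m. if m \<in> range (\<lambda>k. 2 ^ k) then 1 else (0 :: int))) m
               = fps_nth (fps_X * r_fps) m"
      by (auto simp: r_fps_nth image_iff)
  qed
  finally show ?thesis by (simp add: B_fps_def)
qed

fun j_seq :: "nat \<Rightarrow> int" where
  "j_seq n = (if n = 0 then 0 else if even n then j_seq (n div 2) else (-1) ^ (n div 2))"

declare j_seq.simps [simp del]

lemma j_seq_rec:
  "j_seq 0 = 0"
  "j_seq (2 * k) = j_seq k"
  "j_seq (2 * k + 1) = (-1) ^ k"
  by (subst j_seq.simps; simp add: j_seq.simps[of 0])+

definition s_seq :: "nat \<Rightarrow> int" where
  "s_seq n = 1 + (\<Sum>k\<le>n. j_seq k)"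

end

theory Submission
  imports Defs
begin

text \<open>
  If $i + j$ is a power of two, then $i$ and $j$ have equal parity unless $\{i, j\} = \{0, 1\}$.
  Listing even indices before odd ones therefore almost decouples the Hankel matrices
  $([i + j + c \mbox{ is a power of two}])_{i,j}$, $0 \le c \le 3$, into matrices of the same family
  of about half the size; for odd $c$ the two parity classes are instead coupled only to each other.
  The determinants for $c = 1, 2$ turn out to be units, and the one for $c = 0$, divided by the one
  for $c = 2$, obeys the same halving recurrence as minus the partial sums of the sequence $j$.
  The constant term of $B$ only adds the $c = 2$ minor of its corner entry.
\<close>

section \<open>Determinants of matrices given by a function of the indices\<close>

text \<open>Taking the entries from a function on all naturals turns submatrices and reorderings
  into substitutions in the indices.\<close>

definition fdet :: "nat \<Rightarrow> (nat \<Rightarrow> nat \<Rightarrow> 'a) \<Rightarrow> 'a :: idom" where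
  "fdet n f = det (mat n n (\<lambda>(i, j). f i j))"

lemma fdet_cong:
  assumes "\<And>i j. i < n \<Longrightarrow> j < n \<Longrightarrow> f i j = g i j"
  shows "fdet n f = fdet n g"
  unfolding fdet_def using assms by (intro arg_cong[of _ _ det] eq_matI) auto

lemma fdet_0 [simp]: "fdet 0 f = 1"
  by (simp add: fdet_def)

lemma fdet_leibniz:
  "fdet n f = (\<Sum>p | p permutes {0..<n}. signof p * (\<Prod>i = 0..<n. f i (p i)))"
  unfolding fdet_def
  by (subst det_def'[of _ n]) (auto intro!: sum.cong prod.cong dest: permutes_in_image)

lemma fdet_transpose: "fdet n (\<lambda>i j. f j i) = fdet n f"
proof -
  have "mat n n (\<lambda>(i, j). f j i) = transpose_mat (mat n n (\<lambda>(i, j). f i j))"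
    by (intro eq_matI) auto
  then show ?thesis
    unfolding fdet_def using det_transpose[of "mat n n (\<lambda>(i, j). f i j)" n] by simp
qed

lemma fdet_uminus: "fdet n (\<lambda>i j. - f i j) = (-1) ^ n * fdet n f"
proof -
  have "mat n n (\<lambda>(i, j). - f i j) = (-1) \<cdot>\<^sub>m mat n n (\<lambda>(i, j). f i j)"
    by (intro eq_matI) auto
  then show ?thesis
    unfolding fdet_def by simp
qed

lemma fdet_permute_rows:
  assumes "p permutes {0..<n}"
  shows "fdet n (\<lambda>i j. f (p i) j) = signof p * fdet n f"
proof -
  have "mat n n (\<lambda>(i, j). f (p i) j) = mat n n (\<lambda>(i, j). mat n n (\<lambda>(i, j). f i j) $$ (p i, j))"
    using permutes_in_image[OF assms] by (intro eq_matI) auto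
  then show ?thesis
    unfolding fdet_def using det_permute_rows[OF _ assms, of "mat n n (\<lambda>(i, j). f i j)"] by simp
qed

lemma fdet_permute_cols:
  assumes "p permutes {0..<n}"
  shows "fdet n (\<lambda>i j. f i (p j)) = signof p * fdet n f"
  using fdet_permute_rows[OF assms, of "\<lambda>i j. f j i"]
    fdet_transpose[of n f] fdet_transpose[of n "\<lambda>i j. f i (p j)"] by simp

lemma fdet_block:
  assumes "\<And>i j. i < a \<Longrightarrow> j < b \<Longrightarrow> f i (a + j) = 0"
  shows "fdet (a + b) f = fdet a f * fdet b (\<lambda>i j. f (a + i) (a + j))"
proof -
  have "mat (a + b) (a + b) (\<lambda>(i, j). f i j) =
    four_block_mat (mat a a (\<lambda>(i, j). f i j)) (0\<^sub>m a b)
      (mat b a (\<lambda>(i, j). f (a + i) j)) (mat b b (\<lambda>(i, j). f (a + i) (a + j)))"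
  proof (intro eq_matI, goal_cases)
    case (1 i j)
    then show ?case using assms[of i "j - a"] by auto
  qed auto
  then show ?thesis
    unfolding fdet_def by (simp add: det_four_block_mat_upper_right_zero[of _ a _ b])
qed

lemma fdet_first_row:
  assumes "\<And>j. j < n \<Longrightarrow> f 0 (Suc j) = 0"
  shows "fdet (Suc n) f = f 0 0 * fdet n (\<lambda>i j. f (Suc i) (Suc j))"
proof -
  have "fdet (1 + n) f = fdet 1 f * fdet n (\<lambda>i j. f (1 + i) (1 + j))"
    using assms by (intro fdet_block) auto
  moreover have "fdet 1 f = f 0 0"
    unfolding fdet_def by (subst det_single) auto
  ultimately show ?thesis by simp
qed

lemma fdet_first_col:
  assumes "\<And>i. i < n \<Longrightarrow> f (Suc i) 0 = 0"
  shows "fdet (Suc n) f = f 0 0 * fdet n (\<lambda>i j. f (Suc i) (Suc j))"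
  using fdet_first_row[of n "\<lambda>i j. f j i"] assms
    fdet_transpose[of "Suc n" f] fdet_transpose[of n "\<lambda>i j. f (Suc i) (Suc j)"] by simp

text \<open>Each Leibniz product has exactly one factor from row 0, and its other factors agree for
  \<open>f\<close>, \<open>g\<close> and \<open>h\<close>.\<close>

lemma fdet_split_first_row:
  assumes "\<And>j. j \<le> n \<Longrightarrow> f 0 j = g 0 j + h 0 j"
    and "\<And>i j. i < n \<Longrightarrow> j \<le> n \<Longrightarrow> f (Suc i) j = g (Suc i) j"
    and "\<And>i j. i < n \<Longrightarrow> j \<le> n \<Longrightarrow> f (Suc i) j = h (Suc i) j"
  shows "fdet (Suc n) f = fdet (Suc n) g + fdet (Suc n) h"
proof -
  have "(\<Prod>i = 0..<Suc n. f i (p i)) = (\<Prod>i = 0..<Suc n. g i (p i)) + (\<Prod>i = 0..<Suc n. h i (p i))"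
    if "p permutes {0..<Suc n}" for p
  proof -
    have p: "p i \<le> n" if "i \<le> n" for i
      using permutes_in_image[OF \<open>p permutes _\<close>, of i] that by auto
    have "(\<Prod>i = 0..<n. f (Suc i) (p (Suc i))) = (\<Prod>i = 0..<n. g (Suc i) (p (Suc i)))"
      "(\<Prod>i = 0..<n. f (Suc i) (p (Suc i))) = (\<Prod>i = 0..<n. h (Suc i) (p (Suc i)))"
      using assms(2,3) p by (auto intro!: prod.cong)
    then show ?thesis
      using assms(1)[OF p[of 0]] by (simp add: prod.atLeast0_lessThan_Suc_shift distrib_right del: prod.op_ivl_Suc)
  qed
  then show ?thesis
    unfolding fdet_leibniz sum.distrib[symmetric] distrib_left[symmetric]
    by (intro sum.cong) auto
qed

text \<open>Row 0 is split into its corner entry and the rest; the first part reduces to the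
  minor.\<close>

lemma fdet_corner:
  "fdet (Suc n) f = f 0 0 * fdet n (\<lambda>i j. f (Suc i) (Suc j)) +
    fdet (Suc n) (\<lambda>i j. if i = 0 \<and> j = 0 then 0 else f i j)"
proof -
  have "fdet (Suc n) f = fdet (Suc n) (\<lambda>i j. if i = 0 \<and> j \<noteq> 0 then 0 else f i j) +
    fdet (Suc n) (\<lambda>i j. if i = 0 \<and> j = 0 then 0 else f i j)"
    by (rule fdet_split_first_row) auto
  then show ?thesis
    by (simp add: fdet_first_row)
qed

text \<open>In the minor, column 0 takes the place of the deleted column 1, so that all other columns
  carry the same index shift as the rows.\<close>

lemma fdet_entry_0_1:
  assumes "n > 0"
  shows "fdet (Suc n) f = fdet (Suc n) (\<lambda>i j. if i = 0 \<and> j = 1 then 0 else f i j) -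
    f 0 1 * fdet n (\<lambda>i j. f (Suc i) (if j = 0 then 0 else Suc j))"
proof -
  let ?g = "\<lambda>i j. if i = 0 \<and> j \<noteq> 1 then 0 else f i j"
  have "fdet (Suc n) f = fdet (Suc n) (\<lambda>i j. if i = 0 \<and> j = 1 then 0 else f i j) + fdet (Suc n) ?g"
    by (rule fdet_split_first_row) auto
  moreover have "transpose 0 1 permutes {0..<Suc n}"
    using assms by (intro permutes_swap_id) auto
  from fdet_permute_cols[OF this, of ?g]
  have "fdet (Suc n) ?g = - fdet (Suc n) (\<lambda>i j. ?g i (transpose 0 1 j))"
    by (simp add: sign_swap_id)
  moreover have "fdet (Suc n) (\<lambda>i j. ?g i (transpose 0 1 j)) =
    f 0 1 * fdet n (\<lambda>i j. f (Suc i) (if j = 0 then 0 else Suc j))"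
    by (subst fdet_first_row) (auto simp: transpose_def intro!: fdet_cong)
  ultimately show ?thesis by simp
qed

section \<open>Splitting determinants by the parity of the indices\<close>

text \<open>The assumption says that \<open>a\<close> and \<open>b\<close> count the even and the
  odd indices below \<open>a + b\<close>.\<close>

lemma evens_first_permutation:
  fixes a b :: nat
  assumes "b = a \<or> a = Suc b"
  obtains p where "p permutes {0..<a + b}" "\<And>i. i < a \<Longrightarrow> p i = 2 * i"
    "\<And>i. i < b \<Longrightarrow> p (a + i) = 2 * i + 1"
proof
  define p where "p i = (if i < a then 2 * i else if i < a + b then 2 * (i - a) + 1 else i)" for i
  have "inj_on p {0..<a + b}"
    by (auto simp: inj_on_def p_def split: if_splits) presburger+
  moreover have "p ` {0..<a + b} \<subseteq> {0..<a + b}"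
    using assms by (auto simp: p_def)
  ultimately have "bij_betw p {0..<a + b} {0..<a + b}"
    by (simp add: bij_betw_def endo_inj_surj)
  then show "p permutes {0..<a + b}"
    by (rule bij_imp_permutes) (auto simp: p_def)
  show "p i = 2 * i" if "i < a" for i
    using that by (simp add: p_def)
  show "p (a + i) = 2 * i + 1" if "i < b" for i
    using that by (simp add: p_def)
qed

text \<open>Reordering rows and columns by the same permutation squares its sign away and leaves a
  block triangular matrix. The one-sided condition fits the matrices of \<open>hdet_0_rec\<close>,
  where a 1 stays at (1, 0).\<close>

lemma fdet_even_odd:
  assumes ab: "b = a \<or> a = Suc b"
    and zero: "\<And>i j. i < a \<Longrightarrow> j < b \<Longrightarrow> f (2 * i) (2 * j + 1) = 0"
  shows "fdet (a + b) f =
    fdet a (\<lambda>i j. f (2 * i) (2 * j)) * fdet b (\<lambda>i j. f (2 * i + 1) (2 * j + 1))"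
proof -
  obtain p where p: "p permutes {0..<a + b}" and
    ev: "\<And>i. i < a \<Longrightarrow> p i = 2 * i" and od: "\<And>i. i < b \<Longrightarrow> p (a + i) = 2 * i + 1"
    using evens_first_permutation[OF ab] by blast
  have "fdet (a + b) (\<lambda>i j. f (p i) (p j)) = signof p * (signof p * fdet (a + b) f)"
    using fdet_permute_rows[OF p, of "\<lambda>i j. f i (p j)"] fdet_permute_cols[OF p, of f] by simp
  then have "fdet (a + b) f = fdet (a + b) (\<lambda>i j. f (p i) (p j))"
    by (simp add: sign_def)
  also have "\<dots> = fdet a (\<lambda>i j. f (p i) (p j)) * fdet b (\<lambda>i j. f (p (a + i)) (p (a + j)))"
    using zero by (intro fdet_block) (simp add: ev od)
  also have "fdet a (\<lambda>i j. f (p i) (p j)) = fdet a (\<lambda>i j. f (2 * i) (2 * j))"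
    by (intro fdet_cong) (simp add: ev)
  also have "fdet b (\<lambda>i j. f (p (a + i)) (p (a + j))) = fdet b (\<lambda>i j. f (2 * i + 1) (2 * j + 1))"
    by (intro fdet_cong) (simp add: od)
  finally show ?thesis .
qed

text \<open>Swapping rows 2i and 2i+1 moves the zero block to even rows and odd columns, as
  \<open>fdet_even_odd\<close> requires. The absolute value absorbs the sign of the swaps.\<close>

lemma abs_fdet_bipartite:
  fixes f :: "nat \<Rightarrow> nat \<Rightarrow> 'a :: linordered_idom"
  assumes zero: "\<And>i j. i < n \<Longrightarrow> j < n \<Longrightarrow> f (2 * i + 1) (2 * j + 1) = 0"
  shows "\<bar>fdet (2 * n) f\<bar> =
    \<bar>fdet n (\<lambda>i j. f (2 * i) (2 * j + 1))\<bar> * \<bar>fdet n (\<lambda>i j. f (2 * i + 1) (2 * j))\<bar>"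
proof -
  define p where "p i = (if i < 2 * n then if even i then i + 1 else i - 1 else i)" for i
  have "p permutes {0..<2 * n}"
  proof (rule bij_imp_permutes)
    have "inj_on p {0..<2 * n}"
      by (rule inj_on_inverseI[of _ p]) (auto simp: p_def elim!: oddE evenE)
    moreover have "p ` {0..<2 * n} \<subseteq> {0..<2 * n}"
      by (auto simp: p_def split: if_splits elim!: oddE evenE)
    ultimately show "bij_betw p {0..<2 * n} {0..<2 * n}"
      by (simp add: bij_betw_def endo_inj_surj)
  qed (auto simp: p_def)
  from fdet_permute_rows[OF this, of f]
  have "\<bar>fdet (2 * n) f\<bar> = \<bar>fdet (n + n) (\<lambda>i j. f (p i) j)\<bar>"
    by (simp add: abs_mult sign_def mult_2)
  also have "fdet (n + n) (\<lambda>i j. f (p i) j) =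
    fdet n (\<lambda>i j. f (p (2 * i)) (2 * j)) * fdet n (\<lambda>i j. f (p (2 * i + 1)) (2 * j + 1))"
    using zero by (intro fdet_even_odd) (auto simp: p_def)
  also have "fdet n (\<lambda>i j. f (p (2 * i)) (2 * j)) = fdet n (\<lambda>i j. f (2 * i + 1) (2 * j))"
    by (intro fdet_cong) (simp add: p_def)
  also have "fdet n (\<lambda>i j. f (p (2 * i + 1)) (2 * j + 1)) = fdet n (\<lambda>i j. f (2 * i) (2 * j + 1))"
    by (intro fdet_cong) (simp add: p_def)
  finally show ?thesis by (simp add: abs_mult mult.commute)
qed

text \<open>Every term of the Leibniz formula vanishes: $\sum_i (i + p(i)) = 2 \sum_i i$ is even, so for
  odd $n$ some $i + p(i)$ is even.\<close>

lemma fdet_odd_bipartite: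
  assumes "odd n" and zero: "\<And>i j. i < n \<Longrightarrow> j < n \<Longrightarrow> even (i + j) \<Longrightarrow> f i j = 0"
  shows "fdet n f = 0"
proof -
  have "\<exists>i\<in>{0..<n}. f i (p i) = 0" if p: "p permutes {0..<n}" for p
  proof (rule ccontr)
    assume *: "\<not> ?thesis"
    have "odd (i + p i)" if "i \<in> {0..<n}" for i
    proof -
      have "f i (p i) \<noteq> 0" "i < n" "p i < n"
        using * that permutes_in_image[OF p, of i] by auto
      then show ?thesis using zero by blast
    qed
    then have "{i \<in> {0..<n}. odd (i + p i)} = {0..<n}" by blast
    then have "even (\<Sum>i = 0..<n. i + p i) \<longleftrightarrow> even n"
      by (subst even_sum_iff) simp_all
    moreover have "(\<Sum>i = 0..<n. i + p i) = 2 * (\<Sum>i = 0..<n. i)"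
      using sum.permute[OF p, of "\<lambda>i. i"] by (simp add: sum.distrib comp_def mult_2)
    ultimately show False using \<open>odd n\<close> by simp
  qed
  then show ?thesis
    unfolding fdet_leibniz by (intro sum.neutral) (auto intro: prod_zero)
qed

section \<open>Hankel determinants of the indicator of the powers of two\<close>

definition pow2 :: "nat \<Rightarrow> int" where
  "pow2 x = of_bool (\<exists>k. x = 2 ^ k)"

lemma pow2_0 [simp]: "pow2 0 = 0"
  and pow2_1 [simp]: "pow2 (Suc 0) = 1"
  by (auto simp: pow2_def intro: exI[of _ 0])

lemma pow2_double [simp]: "pow2 (2 * x) = pow2 x"
proof -
  have "(\<exists>k. 2 * x = 2 ^ k) \<longleftrightarrow> (\<exists>k. x = 2 ^ k)"
  proof safe
    fix k assume "2 * x = 2 ^ k"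
    then show "\<exists>k. x = 2 ^ k" by (cases k) auto
  next
    fix k show "\<exists>l. 2 * 2 ^ k = (2 :: nat) ^ l" by (rule exI[of _ "Suc k"]) simp
  qed
  then show ?thesis by (simp add: pow2_def)
qed

lemma pow2_eqI: "x = 2 * y \<Longrightarrow> pow2 x = pow2 y"
  by simp

lemma pow2_odd: "odd x \<Longrightarrow> x \<noteq> 1 \<Longrightarrow> pow2 x = 0"
  by (auto simp: pow2_def)

text \<open>Deleting row and column 0 raises the shift \<open>c\<close> by 2, while passing to a
  parity class roughly halves it; the shifts 0 to 3 are all that occur.\<close>

definition hdet :: "nat \<Rightarrow> nat \<Rightarrow> int" where
  "hdet c n = fdet n (\<lambda>i j. pow2 (i + j + c))"

lemma hdet_0 [simp]: "hdet c 0 = 1"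
  by (simp add: hdet_def)

text \<open>Indices of opposite parity give an odd argument of at least 3, hence a zero entry.
  Halving the arguments leaves shift 1 on the even and shift 2 on the odd indices.\<close>

lemma hdet_2_rec: "hdet 2 n = hdet 1 (n - n div 2) * hdet 2 (n div 2)"
proof -
  let ?a = "n - n div 2" and ?b = "n div 2"
  let ?f = "\<lambda>i j. pow2 (i + j + 2)"
  have "fdet (?a + ?b) ?f = fdet ?a (\<lambda>i j. ?f (2 * i) (2 * j)) * fdet ?b (\<lambda>i j. ?f (2 * i + 1) (2 * j + 1))"
    by (rule fdet_even_odd) (linarith, simp add: pow2_odd)
  moreover have "?f (2 * i) (2 * j) = pow2 (i + j + 1)" for i j
    by (rule pow2_eqI) simp
  moreover have "?f (2 * i + 1) (2 * j + 1) = pow2 (i + j + 2)" for i j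
    by (rule pow2_eqI) simp
  ultimately show ?thesis by (simp add: hdet_def)
qed

text \<open>The only nonzero entry between indices of equal parity is the 1 at (0, 0). It lies in
  the even block, so the odd block vanishes as required.\<close>

lemma abs_hdet_1_even: "\<bar>hdet 1 (2 * n)\<bar> = \<bar>hdet 1 n\<bar> * \<bar>hdet 1 n\<bar>"
proof -
  have "pow2 (2 * i + (2 * j + 1) + 1) = pow2 (i + j + 1)" for i j
    by (rule pow2_eqI) simp
  moreover have "pow2 (2 * i + 1 + 2 * j + 1) = pow2 (i + j + 1)" for i j
    by (rule pow2_eqI) simp
  ultimately show ?thesis
    unfolding hdet_def by (subst abs_fdet_bipartite) (simp_all add: pow2_odd)
qed

lemma abs_hdet_3_even: "\<bar>hdet 3 (2 * n)\<bar> = \<bar>hdet 2 n\<bar> * \<bar>hdet 2 n\<bar>"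
proof -
  have "pow2 (2 * i + (2 * j + 1) + 3) = pow2 (i + j + 2)" for i j
    by (rule pow2_eqI) simp
  moreover have "pow2 (2 * i + 1 + 2 * j + 3) = pow2 (i + j + 2)" for i j
    by (rule pow2_eqI) simp
  ultimately show ?thesis
    unfolding hdet_def by (subst abs_fdet_bipartite) (simp_all add: pow2_odd)
qed

lemma hdet_3_odd: "odd n \<Longrightarrow> hdet 3 n = 0"
  unfolding hdet_def by (rule fdet_odd_bipartite) (auto simp: pow2_odd)

text \<open>Without its corner entry the matrix couples only opposite parities, so its determinant
  vanishes in odd size. What remains is the corner minor, of shift 3.\<close>

lemma hdet_1_odd: "even n \<Longrightarrow> hdet 1 (Suc n) = hdet 3 n"
proof -
  assume "even n"
  then have "fdet (Suc n) (\<lambda>i j. if i = 0 \<and> j = 0 then 0 else pow2 (i + j + 1)) = 0"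
    by (intro fdet_odd_bipartite) (auto simp: pow2_odd)
  then show ?thesis
    unfolding hdet_def by (subst fdet_corner) (simp add: numeral_3_eq_3)
qed

text \<open>Both shifts need one joint induction: odd sizes of shift 1 lead through shift 3 to shift
  2, and shift 2 leads back to shift 1.\<close>

lemma abs_hdet_1_2: "\<bar>hdet 1 n\<bar> = 1 \<and> \<bar>hdet 2 n\<bar> = 1"
proof (induction n rule: less_induct)
  case (less n)
  show ?case
  proof (cases "n = 0")
    case False
    have 1: "\<bar>hdet 1 n\<bar> = 1"
    proof (cases "even n")
      case True
      then obtain m where "n = 2 * m" by blast
      then show ?thesis using less[of m] False abs_hdet_1_even[of m] by simp
    next
      case False
      then obtain m where "n = Suc (2 * m)" by (metis oddE Suc_eq_plus1)
      then show ?thesis using less[of m] abs_hdet_3_even[of m] hdet_1_odd[of "2 * m"] by simp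
    qed
    have "\<bar>hdet 1 (n - n div 2)\<bar> = 1"
    \<comment> \<open>For positive \<open>n\<close>, the size \<open>n - n div 2\<close> fails to be
      smaller than \<open>n\<close> only at \<open>n = 1\<close>, where the claim just shown for
      shift 1 applies.\<close>
    proof (cases "n = 1")
      case False
      then show ?thesis using less[of "n - n div 2"] \<open>n \<noteq> 0\<close> by simp
    qed (use 1 in simp)
    then have "\<bar>hdet 2 n\<bar> = 1"
      using less[of "n div 2"] False hdet_2_rec[of n] by (simp add: abs_mult)
    with 1 show ?thesis by simp
  qed simp
qed

text \<open>The parity classes are coupled only by the entries 1 at (0, 1) and (1, 0). Clearing the
  first gives the leading product; its cofactor gives the subtracted one.\<close>

lemma hdet_0_rec:
  assumes "n > 0"
  shows "hdet 0 (Suc n) = hdet 0 (Suc (n div 2)) * hdet 1 (n - n div 2) -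
    hdet 2 (n div 2) * hdet 3 (n - n div 2 - 1)"
proof -
  \<comment> \<open>The full matrix has \<open>Suc b\<close> even and \<open>m\<close> odd indices;
    the minor of size \<open>n\<close> has \<open>m\<close> even and \<open>b\<close> odd
    ones.\<close>
  define b m where "b = n div 2" and "m = n - n div 2"
  have bm: "b = m \<or> m = Suc b" "Suc b = m \<or> Suc b = Suc m" "n = m + b" "m > 0"
    using assms by (auto simp: b_def m_def)
  have tw: "pow2 (2 * i + 2 * j) = pow2 (i + j)" for i j
    by (rule pow2_eqI) simp
  let ?f = "\<lambda>i j. if i = 0 \<and> j = Suc 0 then 0 else pow2 (i + j)"
  have "fdet (Suc b + m) ?f =
      fdet (Suc b) (\<lambda>i j. ?f (2 * i) (2 * j)) * fdet m (\<lambda>i j. ?f (2 * i + 1) (2 * j + 1))"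
    using bm by (intro fdet_even_odd) (auto simp: pow2_odd)
  moreover have "?f (2 * i) (2 * j) = pow2 (i + j)" for i j
    using tw by auto
  moreover have "?f (2 * i + 1) (2 * j + 1) = pow2 (i + j + 1)" for i j
    using pow2_double[of "i + j + 1"] by (simp add: algebra_simps)
  ultimately have 1: "fdet (Suc n) ?f = hdet 0 (Suc b) * hdet 1 m"
    using bm by (simp add: hdet_def add.commute)
  let ?g = "\<lambda>i j. pow2 (Suc i + (if j = 0 then 0 else Suc j))"
  have "fdet (m + b) ?g =
      fdet m (\<lambda>i j. ?g (2 * i) (2 * j)) * fdet b (\<lambda>i j. ?g (2 * i + 1) (2 * j + 1))"
    using bm by (intro fdet_even_odd) (auto simp: pow2_odd)
  moreover have "?g (2 * i + 1) (2 * j + 1) = pow2 (i + j + 2)" for i j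
    by (rule pow2_eqI) simp
  moreover have "fdet m (\<lambda>i j. ?g (2 * i) (2 * j)) = hdet 3 (m - 1)"
  proof -
    have "?g (2 * Suc i) (2 * Suc j) = pow2 (i + j + 3)" for i j
      by (rule pow2_eqI) simp
    \<comment> \<open>Column 0 of the even block holds \<open>pow2 (2 * i + 1)\<close>, which is 1
      at the top and 0 below.\<close>
    moreover have "fdet (Suc (m - 1)) (\<lambda>i j. ?g (2 * i) (2 * j)) =
      ?g (2 * 0) (2 * 0) * fdet (m - 1) (\<lambda>i j. ?g (2 * Suc i) (2 * Suc j))"
      by (rule fdet_first_col) (simp add: pow2_odd)
    ultimately show ?thesis using bm by (simp add: hdet_def)
  qed
  ultimately have 2: "fdet n ?g = hdet 3 (m - 1) * hdet 2 b"
    using bm by (simp add: hdet_def)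
  have "hdet 0 (Suc n) = fdet (Suc n) ?f - fdet n ?g"
    unfolding hdet_def using fdet_entry_0_1[OF assms, of "\<lambda>i j. pow2 (i + j + 0)"] by simp
  then show ?thesis
    using 1 2 by (simp add: b_def m_def)
qed

section \<open>The partial sums of the sequence j\<close>

lemma sum_atMost_even_odd:
  fixes g :: "nat \<Rightarrow> 'a :: comm_monoid_add"
  shows "(\<Sum>k\<le>n. g k) = (\<Sum>k\<le>n div 2. g (2 * k)) + (\<Sum>k<n - n div 2. g (2 * k + 1))"
proof (induction n)
  case (Suc n)
  show ?case
  proof (cases "even n")
    case True
    then obtain m where "n = 2 * m" by blast
    then show ?thesis using Suc by (simp add: ac_simps Suc_diff_le)
  next
    case False
    then obtain m where m: "n = Suc (2 * m)" by (metis oddE Suc_eq_plus1)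
    then have "n div 2 = m" "n - n div 2 = Suc m" "Suc n div 2 = Suc m" "Suc n - Suc n div 2 = Suc m"
      by auto
    then show ?thesis using Suc m by (simp add: ac_simps)
  qed
qed simp

lemma sum_alternating: "(\<Sum>k<m. (-1) ^ k :: int) = of_bool (odd m)"
  by (induction m) auto

text \<open>The even indices reproduce the sum up to \<open>n div 2\<close>; the odd ones contribute
  an alternating sum of signs.\<close>

lemma j_sum_rec: "(\<Sum>k\<le>n. j_seq k) = (\<Sum>k\<le>n div 2. j_seq k) + of_bool (odd (n - n div 2))"
  by (subst sum_atMost_even_odd) (simp add: j_seq_rec[unfolded Suc_eq_plus1[symmetric]] sum_alternating)

lemma j_sum_nonneg: "0 \<le> (\<Sum>k\<le>n. j_seq k)"
proof (induction n rule: less_induct)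
  case (less n)
  show ?case
  proof (cases "n = 0")
    case False
    then show ?thesis using less[of "n div 2"] by (subst j_sum_rec) simp
  qed (simp add: j_seq_rec)
qed

text \<open>Factoring \<open>hdet 2 n\<close> out of \<open>hdet_0_rec\<close> by means of
  \<open>hdet_2_rec\<close> leaves the recurrence \<open>j_sum_rec\<close> up to sign.\<close>

lemma hdet_0_eq: "hdet 0 (Suc n) = - hdet 2 n * (\<Sum>k\<le>n. j_seq k)"
proof (induction n rule: less_induct)
  case (less n)
  show ?case
  proof (cases "n = 0")
    case True
    then show ?thesis by (simp add: hdet_def fdet_first_row j_seq_rec)
  next
    case False
    define m where "m = n - n div 2"
    \<comment> \<open>This identity turns the subtracted term of \<open>hdet_0_rec\<close> into the
      parity term of \<open>j_sum_rec\<close>.\<close>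
    have "hdet 3 (m - 1) = of_bool (odd m) * hdet 1 m"
    proof (cases "odd m")
      case True
      then show ?thesis using hdet_1_odd[of "m - 1"] by (simp add: odd_pos)
    next
      case even: False
      have "m > 0" using False by (simp add: m_def)
      then have "odd (m - 1)" using even by simp
      then show ?thesis using hdet_3_odd even by simp
    qed
    then show ?thesis
      using False less[of "n div 2"] hdet_0_rec[of n] hdet_2_rec[of n]
      by (subst j_sum_rec) (simp add: m_def[symmetric] algebra_simps)
  qed
qed

section \<open>The coefficients of B and the conclusion\<close>

lemma B_fps_nth: "fps_nth B_fps x = (if x = 0 then 1 else - pow2 x)"
proof (cases x)
  case (Suc y)
  have "(\<exists>k. y = 2 ^ k - 1) \<longleftrightarrow> (\<exists>k. Suc y = 2 ^ k)"
    by (metis Suc_pred' diff_Suc_1 pos2 zero_less_power)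
  with Suc show ?thesis by (simp add: B_fps_def r_fps_nth pow2_def)
qed (simp add: B_fps_def)

theorem theorem22:
  fixes n :: nat
  shows "\<bar>hankel_det B_fps (n + 1)\<bar> = s_seq n"
proof -
  have "hankel_det B_fps (n + 1) = fdet (Suc n) (\<lambda>i j. fps_nth B_fps (i + j))"
    by (simp add: hankel_det_def fdet_def)
  \<comment> \<open>Since \<open>pow2 0 = 0\<close>, the matrix with its corner cleared is exactly
    the negated matrix of shift 0.\<close>
  also have "\<dots> = fdet n (\<lambda>i j. - pow2 (i + j + 2)) + fdet (Suc n) (\<lambda>i j. - pow2 (i + j))"
    by (subst fdet_corner) (auto simp: B_fps_nth intro!: arg_cong2[of _ _ _ _ plus] fdet_cong)
  \<comment> \<open>The corner minor supplies the summand 1 of \<open>s_seq n\<close>; the two minus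
    signs in the other term, from the extra row and from \<open>hdet_0_eq\<close>, cancel.\<close>
  also have "\<dots> = (-1) ^ n * hdet 2 n * s_seq n"
    unfolding fdet_uminus using hdet_0_eq[of n]
    by (simp add: hdet_def s_seq_def algebra_simps)
  finally show ?thesis
    using abs_hdet_1_2[of n] j_sum_nonneg[of n] by (simp add: abs_mult power_abs s_seq_def)
qed

end
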